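(* Let $G$ be a graph and let $t\ge 1$ be an integer. If $G$ does not admit $K_t$ as a weak immersion, then there exists a tree-cut decomposition $(T,\mathcal{X})$ of $G$ of adhesion less than $t^2$ such that, for every $s \in V(T)$, the torso of $(G,T,\mathcal{X})$ at $s$ has $(t,t^2)$-bounded degree.
   Context: Graphs are finite and may have multiple (parallel) edges but no loops. $\delta(X)$ denotes the set of edges with exactly one endpoint in the vertex set $X$. $K_t$ is the complete graph on $t$ vertices. Weak immersion: $G$ admits a weak immersion of $H$ if there is an injection $\pi_v: V(H)\to V(G)$ and a map $\pi_e$ from $E(H)$ to subgraphs of $G$ such that for every edge $f$ of $H$ with endpoints $x,y$, $\pi_e(f)$ is a path with endpoints $\pi_v(x),\pi_v(y)$, and for distinct edges $f,f'$ of $H$ the paths $\pi_e(f),\pi_e(f')$ have no edge in common. $(\alpha,\beta)$-bounded degree: a graph has $(\alpha,\beta)$-bounded degree if at most $\alpha$ of its vertices have degree at least $\beta$. Tree-cut decomposition: a near-partition of a set is a family of pairwise disjoint, possibly empty, subsets whose union is the whole set. A tree-cut decomposition of $G$ is a pair $(T,\mathcal{X})$ where $T$ is a tree and $\mathcal{X}=\{X_s\subseteq V(G): s\in V(T)\}$ is a near-partition of $V(G)$ indexed by $V(T)$. For an edge $uv$ of $T$, let $T_v$ be the component of $T-uv$ containing $v$. The adhesion of the decomposition is $\max_{uv\in E(T)}\left|\delta\left(\bigcup_{s\in V(T_v)}X_s\right)\right|$ if $T$ has at least one edge, and $0$ otherwise. Torso: consolidating a vertex set $Z$ means deleting all edges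 with both ends in $Z$ and identifying $Z$ to a single vertex. If $|V(T)|=1$, the torso at the unique vertex is $G$. Otherwise, for $s\in V(T)$ let $T_1,\dots,T_l$ be the components of $T-s$ and $Z_i=\bigcup_{x\in V(T_i)}X_x$; the torso of $(G,T,\mathcal{X})$ at $s$ is the graph obtained from $G$ by consolidating each $Z_i$ to a single vertex $z_i$ (if $Z_i=\emptyset$, $z_i$ is an isolated vertex). *)

theory Defs
  imports Main "HOL-Library.Disjoint_Sets"
begin

record ('v, 'e) graph =
  verts :: "'v set"
  edges :: "'e set"
  ends :: "'e \<Rightarrow> 'v set"

text \<open>Edges have their own identity, so parallel edges are allowed; requiring two distinct ends
  excludes loops. The empty graph is allowed.\<close>

definition multigraph :: "('v, 'e) graph \<Rightarrow> bool" where
  "multigraph G \<longleftrightarrow> finite (verts G) \<and> finite (edges G) \<and>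
     (\<forall>e\<in>edges G. ends G e \<subseteq> verts G \<and> card (ends G e) = 2)"

definition cut :: "('v, 'e) graph \<Rightarrow> 'v set \<Rightarrow> 'e set" where
  "cut G X = {e \<in> edges G. card (ends G e \<inter> X) = 1}"

definition degree :: "('v, 'e) graph \<Rightarrow> 'v \<Rightarrow> nat" where
  "degree G v = card {e \<in> edges G. v \<in> ends G e}"

definition bounded_degree :: "nat \<Rightarrow> nat \<Rightarrow> ('v, 'e) graph \<Rightarrow> bool" where
  "bounded_degree \<alpha> \<beta> G \<longleftrightarrow> card {v \<in> verts G. degree G v \<ge> \<beta>} \<le> \<alpha>"

definition complete_graph :: "nat \<Rightarrow> (nat, nat set) graph" where
  "complete_graph t = \<lparr>verts = {..<t}, edges = {e. e \<subseteq> {..<t} \<and> card e = 2}, ends = (\<lambda>e. e)\<rparr>"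

definition walk :: "('v, 'e) graph \<Rightarrow> 'v list \<Rightarrow> 'e list \<Rightarrow> bool" where
  "walk G vs es \<longleftrightarrow> length vs = Suc (length es) \<and> set vs \<subseteq> verts G \<and> set es \<subseteq> edges G \<and>
     (\<forall>i<length es. ends G (es ! i) = {vs ! i, vs ! Suc i})"

definition subgraph :: "('v, 'e) graph \<Rightarrow> ('v, 'e) graph \<Rightarrow> bool" where
  "subgraph P G \<longleftrightarrow> verts P \<subseteq> verts G \<and> edges P \<subseteq> edges G \<and> (\<forall>e\<in>edges P. ends P e = ends G e)"

definition path_graph :: "('v, 'e) graph \<Rightarrow> 'v \<Rightarrow> 'v \<Rightarrow> bool" where
  "path_graph P x y \<longleftrightarrow> (\<exists>vs es. walk P vs es \<and> distinct vs \<and> hd vs = x \<and> last vs = y \<and>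
     verts P = set vs \<and> edges P = set es)"

definition weak_immersion ::
  "('v, 'e) graph \<Rightarrow> ('w, 'f) graph \<Rightarrow> ('w \<Rightarrow> 'v) \<Rightarrow> ('f \<Rightarrow> ('v, 'e) graph) \<Rightarrow> bool" where
  "weak_immersion G H \<pi>v \<pi>e \<longleftrightarrow>
     inj_on \<pi>v (verts H) \<and> \<pi>v ` verts H \<subseteq> verts G \<and>
     (\<forall>f\<in>edges H. subgraph (\<pi>e f) G) \<and>
     (\<forall>f\<in>edges H. \<forall>x y. ends H f = {x, y} \<longrightarrow> path_graph (\<pi>e f) (\<pi>v x) (\<pi>v y)) \<and>
     (\<forall>f\<in>edges H. \<forall>f'\<in>edges H. f \<noteq> f' \<longrightarrow> edges (\<pi>e f) \<inter> edges (\<pi>e f') = {})"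

definition admits_weak_immersion :: "('v, 'e) graph \<Rightarrow> ('w, 'f) graph \<Rightarrow> bool" where
  "admits_weak_immersion G H \<longleftrightarrow> (\<exists>\<pi>v \<pi>e. weak_immersion G H \<pi>v \<pi>e)"

definition component :: "('v, 'e) graph \<Rightarrow> 'v \<Rightarrow> 'v set" where
  "component G v = {w. \<exists>vs es. walk G vs es \<and> hd vs = v \<and> last vs = w}"

definition components :: "('v, 'e) graph \<Rightarrow> 'v set set" where
  "components G = component G ` verts G"

definition connected :: "('v, 'e) graph \<Rightarrow> bool" where
  "connected G \<longleftrightarrow> verts G \<noteq> {} \<and> (\<forall>v\<in>verts G. \<forall>w\<in>verts G. w \<in> component G v)"

text \<open>A pair of parallel edges is a cycle; traversing one edge back and forth is not.\<close>

definition cycle :: "('v, 'e) graph \<Rightarrow> 'v list \<Rightarrow> 'e list \<Rightarrow> bool" where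
  "cycle G vs es \<longleftrightarrow> walk G vs es \<and> es \<noteq> [] \<and> hd vs = last vs \<and> distinct (tl vs) \<and> distinct es"

definition tree :: "('v, 'e) graph \<Rightarrow> bool" where
  "tree T \<longleftrightarrow> multigraph T \<and> connected T \<and> (\<nexists>vs es. cycle T vs es)"

definition delete_edge :: "('v, 'e) graph \<Rightarrow> 'e \<Rightarrow> ('v, 'e) graph" where
  "delete_edge G e = G\<lparr>edges := edges G - {e}\<rparr>"

definition delete_vertex :: "('v, 'e) graph \<Rightarrow> 'v \<Rightarrow> ('v, 'e) graph" where
  "delete_vertex G v = G\<lparr>verts := verts G - {v}, edges := {e \<in> edges G. v \<notin> ends G e}\<rparr>"

definition tree_cut_decomposition ::
  "('v, 'e) graph \<Rightarrow> ('s, 'f) graph \<Rightarrow> ('s \<Rightarrow> 'v set) \<Rightarrow> bool" where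
  "tree_cut_decomposition G T X \<longleftrightarrow>
     tree T \<and> disjoint_family_on X (verts T) \<and> (\<Union>s\<in>verts T. X s) = verts G"

text \<open>The maximum ranges over both orientations of every tree edge; the two cuts coincide.\<close>

definition adhesion :: "('v, 'e) graph \<Rightarrow> ('s, 'f) graph \<Rightarrow> ('s \<Rightarrow> 'v set) \<Rightarrow> nat" where
  "adhesion G T X =
     (if edges T = {} then 0
      else Max {card (cut G (\<Union>s\<in>component (delete_edge T f) v. X s)) | f v.
                  f \<in> edges T \<and> v \<in> ends T f})"

text \<open>Simultaneous consolidation of the pairwise disjoint vertex sets \<open>Z i\<close>, \<open>i \<in> I\<close>: a vertex
  \<open>x\<close> outside all of them survives as \<open>Inl x\<close>, and \<open>Z i\<close> becomes the single vertex \<open>Inr i\<close>,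
  which is isolated if \<open>Z i\<close> is empty.\<close>

definition consolidate ::
  "('v, 'e) graph \<Rightarrow> 'i set \<Rightarrow> ('i \<Rightarrow> 'v set) \<Rightarrow> ('v + 'i, 'e) graph" where
  "consolidate G I Z =
     \<lparr>verts = Inl ` (verts G - (\<Union>i\<in>I. Z i)) \<union> Inr ` I,
      edges = {e \<in> edges G. \<not> (\<exists>i\<in>I. ends G e \<subseteq> Z i)},
      ends = (\<lambda>e. Inl ` (ends G e - (\<Union>i\<in>I. Z i)) \<union> Inr ` {i \<in> I. ends G e \<inter> Z i \<noteq> {}})\<rparr>"

text \<open>If \<open>s\<close> is the only vertex of \<open>T\<close>, there are no components to consolidate and the torso is the
  copy of \<open>G\<close> under \<open>Inl\<close>.\<close>

definition torso ::
  "('v, 'e) graph \<Rightarrow> ('s, 'f) graph \<Rightarrow> ('s \<Rightarrow> 'v set) \<Rightarrow> 's \<Rightarrow> ('v + 's set, 'e) graph" where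
  "torso G T X s = consolidate G (components (delete_vertex T s)) (\<lambda>C. \<Union>x\<in>C. X x)"

end

theory Submission
  imports Defs
begin

text \<open>Call two vertices linked if no edge cut with fewer than \<open>t\<^sup>2\<close> edges separates them. This is
  an equivalence relation, and the decomposition has its classes as the nonempty bags. Two facts
  make this work.

  \<^emph>\<open>Classes are small.\<close> If \<open>t = n + 1\<close> vertices are pairwise linked, choose one of them as a hub
  \<open>r\<close>. A cut separating some of the other vertices from \<open>r\<close> has at least \<open>n\<^sup>2\<close> edges, so by Menger's
  theorem with multiplicities there are \<open>n\<^sup>2\<close> edge-disjoint connections to \<open>r\<close>, with \<open>n\<close> of them
  starting at each of the \<open>n\<close> others (\<open>edge_disjoint_connections\<close>). Joining at the hub the
  connection that vertex \<open>i\<close> reserves for \<open>j\<close> with the one that \<open>j\<close> reserves for \<open>i\<close> gives an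
  immersion of \<open>K\<^sub>t\<close> (\<open>clique_immersion_of_highly_connected_set\<close>). Hence every class has fewer than
  \<open>t\<close> vertices.

  \<^emph>\<open>Classes are separated by a laminar family.\<close> Among the laminar families of cuts with fewer than
  \<open>t\<^sup>2\<close> edges, each of them a minimum cut for some pair of vertices, take a largest one. If it
  separated too few pairs, a minimum cut for a missed pair could be uncrossed from all its members
  and added (\<open>exists_laminar_separating_family\<close>).

  A laminar family is the same as a rooted tree in which the members correspond to the tree edges,
  so it yields a tree-cut decomposition of adhesion less than \<open>t\<^sup>2\<close>. In a torso, a vertex obtained by
  consolidation has as its degree the size of one of these cuts. Vertices of degree at least \<open>t\<^sup>2\<close>
  can therefore only come from the bag, which has fewer than \<open>t\<close> vertices
  (\<open>torso_bounded_degree\<close>).\<close>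

section \<open>Submodularity\<close>

lemma card_filter_eq_sum: "finite D \<Longrightarrow> card {x \<in> D. P x} = (\<Sum>x\<in>D. of_bool (P x))"
  by (simp add: Int_def)

definition out_arcs :: "('v \<times> 'e \<times> 'v) set \<Rightarrow> 'v set \<Rightarrow> ('v \<times> 'e \<times> 'v) set" where
  "out_arcs D A = {\<alpha> \<in> D. fst \<alpha> \<in> A \<and> snd (snd \<alpha>) \<notin> A}"

lemma out_arcs_submodular:
  assumes "finite D"
  shows "card (out_arcs D (A \<union> B)) + card (out_arcs D (A \<inter> B))
    \<le> card (out_arcs D A) + card (out_arcs D B)"
  unfolding out_arcs_def card_filter_eq_sum[OF assms] sum.distrib[symmetric]
  by (intro sum_mono) auto

lemma card_tokens_modular:
  assumes "finite K"
  shows "card {k \<in> K. pos k \<in> A \<union> B} + card {k \<in> K. pos k \<in> A \<inter> B}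
    = card {k \<in> K. pos k \<in> A} + card {k \<in> K. pos k \<in> B}"
  unfolding card_filter_eq_sum[OF assms] sum.distrib[symmetric]
  by (intro sum.cong) auto

lemma card_ends_Int_eq_1:
  "a \<noteq> b \<Longrightarrow> card ({a, b} \<inter> X) = 1 \<longleftrightarrow> (a \<in> X) \<noteq> (b \<in> X)"
  by (cases "a \<in> X"; cases "b \<in> X") auto

lemma multigraph_edgeE:
  assumes "multigraph G" "e \<in> edges G"
  obtains a b where "ends G e = {a, b}" "a \<noteq> b" "a \<in> verts G" "b \<in> verts G"
proof -
  have "ends G e \<subseteq> verts G" "card (ends G e) = 2"
    using assms by (auto simp: multigraph_def)
  then show ?thesis
    using that by (auto simp: card_2_iff)
qed

lemma cut_submodular:
  assumes "multigraph G"
  shows "card (cut G (A \<union> B)) + card (cut G (A \<inter> B)) \<le> card (cut G A) + card (cut G B)"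
proof -
  have fin: "finite (edges G)"
    using assms by (simp add: multigraph_def)
  show ?thesis
    unfolding cut_def card_filter_eq_sum[OF fin] sum.distrib[symmetric]
  proof (rule sum_mono)
    fix e assume "e \<in> edges G"
    then obtain a b where ab: "ends G e = {a, b}" "a \<noteq> b"
      using multigraph_edgeE[OF assms] by metis
    show "of_bool (card (ends G e \<inter> (A \<union> B)) = 1) + of_bool (card (ends G e \<inter> (A \<inter> B)) = 1)
        \<le> (of_bool (card (ends G e \<inter> A) = 1) + of_bool (card (ends G e \<inter> B) = 1) :: nat)"
      by (simp only: ab(1) card_ends_Int_eq_1[OF ab(2)]) auto
  qed
qed

lemma cut_complement:
  assumes "multigraph G"
  shows "cut G (verts G - A) = cut G A"
  unfolding cut_def
proof (intro Collect_cong conj_cong refl)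
  fix e assume "e \<in> edges G"
  then obtain a b where ab: "ends G e = {a, b}" "a \<noteq> b" and "a \<in> verts G" "b \<in> verts G"
    using multigraph_edgeE[OF assms] by metis
  then show "card (ends G e \<inter> (verts G - A)) = 1 \<longleftrightarrow> card (ends G e \<inter> A) = 1"
    by (simp only: ab(1) card_ends_Int_eq_1[OF ab(2)]) auto
qed

text \<open>Submodularity for \<open>A\<close> and the complement of \<open>B\<close>, whose cuts are those of \<open>B\<close> and of its
  complement.\<close>

lemma cut_posimodular:
  assumes "multigraph G" "A \<subseteq> verts G" "B \<subseteq> verts G"
  shows "card (cut G (A - B)) + card (cut G (B - A)) \<le> card (cut G A) + card (cut G B)"
proof -
  have "A \<inter> (verts G - B) = A - B" "A \<union> (verts G - B) = verts G - (B - A)"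
    using assms by auto
  then show ?thesis
    using cut_submodular[OF assms(1), of A "verts G - B"] by (simp add: cut_complement[OF assms(1)])
qed

section \<open>Edge-disjoint connections to a root\<close>

text \<open>The hypothesis of Menger's theorem for many sources and one sink: \<open>pos\<close> places tokens \<open>k \<in> K\<close> on
  vertices, and all of them are to travel to a root outside \<open>W\<close> along distinct arcs. An arc
  \<open>(a, e, b)\<close> traverses the edge \<open>e\<close> from \<open>a\<close> to \<open>b\<close>; keeping \<open>e\<close> distinguishes parallel arcs.\<close>

definition meets_demand ::
  "('v \<times> 'e \<times> 'v) set \<Rightarrow> 'v set \<Rightarrow> 'k set \<Rightarrow> ('k \<Rightarrow> 'v) \<Rightarrow> bool" where
  "meets_demand D W K pos \<longleftrightarrow>
     (\<forall>A\<subseteq>W. card {k \<in> K. pos k \<in> A} \<le> card (out_arcs D A))"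

definition arc_step :: "('v \<times> 'e \<times> 'v) set \<Rightarrow> ('v \<times> 'v) set" where
  "arc_step B = {(a, b). \<exists>e. (a, e, b) \<in> B}"

lemma finite_out_arcs: "finite D \<Longrightarrow> finite (out_arcs D A)"
  by (simp add: out_arcs_def)

lemma out_arcs_remove:
  "out_arcs (D - {\<alpha>}) A = out_arcs D A - {\<alpha>}"
  by (auto simp: out_arcs_def)

text \<open>This reduces the undirected problem to a directed one: starting from both directions of every
  edge, one direction of each can be given up. In a smallest arc set that still meets the demand every arc leaves a
  tight set, that is, a set with exactly as many leaving arcs as tokens. If both directions of an
  edge survived, they would leave two tight sets \<open>A\<close> and \<open>B\<close> and run between \<open>A - B\<close> and \<open>B - A\<close>.
  Such arcs do not leave \<open>A \<union> B\<close> or \<open>A \<inter> B\<close>, so submodularity holds with slack \<open>2\<close>, which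
  contradicts tightness.\<close>

lemma exists_orientation_meeting_demand:
  assumes fin: "finite D0" "finite K"
    and dem: "meets_demand D0 W K pos"
  shows "\<exists>D\<subseteq>D0. meets_demand D W K pos \<and> (\<forall>a e b. (a, e, b) \<in> D \<longrightarrow> (b, e, a) \<notin> D)"
proof -
  define P where "P D \<longleftrightarrow> D \<subseteq> D0 \<and> meets_demand D W K pos" for D
  have "P D0"
    using dem by (simp add: P_def)
  then obtain D where D: "P D" and min: "\<And>D'. P D' \<Longrightarrow> card D \<le> card D'"
    using ex_has_least_nat[of P D0 card] by blast
  have finD: "finite D"
    using D fin finite_subset by (auto simp: P_def)
  have tight: "\<exists>A\<subseteq>W. \<alpha> \<in> out_arcs D A \<and> card {k \<in> K. pos k \<in> A} = card (out_arcs D A)"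
    if "\<alpha> \<in> D" for \<alpha>
  proof -
    have "card (D - {\<alpha>}) < card D"
      using that finD by (intro card_Diff1_less)
    then have "\<not> P (D - {\<alpha>})"
      using min by fastforce
    then obtain A where A: "A \<subseteq> W" "card (out_arcs (D - {\<alpha>}) A) < card {k \<in> K. pos k \<in> A}"
      using D by (auto simp: P_def meets_demand_def not_le)
    have le: "card {k \<in> K. pos k \<in> A} \<le> card (out_arcs D A)"
      using D A by (auto simp: P_def meets_demand_def)
    have "\<alpha> \<in> out_arcs D A"
      using A(2) le unfolding out_arcs_remove by (metis Diff_empty Diff_insert0 not_le)
    moreover have "card (out_arcs (D - {\<alpha>}) A) = card (out_arcs D A) - 1"
      unfolding out_arcs_remove using calculation by simp
    ultimately show ?thesis
      using A le by (intro exI[of _ A]) auto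
  qed
  have "(b, e, a) \<notin> D" if ab: "(a, e, b) \<in> D" for a e b
  proof
    assume ba: "(b, e, a) \<in> D"
    obtain A where A: "A \<subseteq> W" "(a, e, b) \<in> out_arcs D A"
      "card {k \<in> K. pos k \<in> A} = card (out_arcs D A)"
      using tight[OF ab] by blast
    obtain B where B: "B \<subseteq> W" "(b, e, a) \<in> out_arcs D B"
      "card {k \<in> K. pos k \<in> B} = card (out_arcs D B)"
      using tight[OF ba] by blast
    have ab_sides: "a \<in> A" "b \<notin> A" "b \<in> B" "a \<notin> B"
      using A B by (auto simp: out_arcs_def)
    \<comment> \<open>Submodularity is applied without the two arcs: this lowers the counts for \<open>A\<close> and \<open>B\<close> by
      one each and leaves those for \<open>A \<union> B\<close> and \<open>A \<inter> B\<close> unchanged.\<close>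
    define D' where "D' = D - {(a, e, b), (b, e, a)}"
    have finD': "finite D'"
      using finD by (simp add: D'_def)
    have "out_arcs D' A = out_arcs D A - {(a, e, b)}" "out_arcs D' B = out_arcs D B - {(b, e, a)}"
      using ab_sides by (auto simp: out_arcs_def D'_def)
    then have less: "card (out_arcs D' A) < card (out_arcs D A)"
      "card (out_arcs D' B) < card (out_arcs D B)"
      using A(2) B(2) card_Diff1_less finite_out_arcs[OF finD] by metis+
    have eq: "out_arcs D' (A \<union> B) = out_arcs D (A \<union> B)" "out_arcs D' (A \<inter> B) = out_arcs D (A \<inter> B)"
      using ab_sides by (auto simp: out_arcs_def D'_def)
    have "card {k \<in> K. pos k \<in> A \<union> B} \<le> card (out_arcs D (A \<union> B))"
      "card {k \<in> K. pos k \<in> A \<inter> B} \<le> card (out_arcs D (A \<inter> B))"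
      using D A(1) B(1) unfolding P_def meets_demand_def by blast+
    then show False
      using card_tokens_modular[OF fin(2), of pos A B] out_arcs_submodular[OF finD', of A B]
        A(3) B(3) less unfolding eq by linarith
  qed
  then show ?thesis
    using D unfolding P_def by blast
qed

text \<open>The directed Menger theorem, proved by moving one token along one arc and deleting that arc.
  Moving a token from \<open>u\<close> along an arc to \<open>w\<close> can break the demand condition only for a tight set
  that contains \<open>w\<close> but not \<open>u\<close>. Unions of tight sets are tight, so there is a largest tight set
  \<open>M\<close> that avoids \<open>u\<close>, and it suffices that \<open>w \<notin> M\<close>. Some arc at \<open>u\<close> qualifies: otherwise
  \<open>insert u M\<close> has no more leaving arcs than \<open>M\<close>, but strictly more tokens.\<close>

lemma tokens_walk_to_root:
  assumes "finite D" "finite K" "finite W" "r \<notin> W"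
    and "\<And>a e b. (a, e, b) \<in> D \<Longrightarrow> b \<in> insert r W"
    and "\<And>k. k \<in> K \<Longrightarrow> pos k \<in> insert r W"
    and "meets_demand D W K pos"
  shows "\<exists>B. (\<forall>k\<in>K. B k \<subseteq> D \<and> (pos k, r) \<in> (arc_step (B k))\<^sup>*) \<and> disjoint_family_on B K"
  using assms
proof (induction "card D" arbitrary: D pos rule: less_induct)
  case less
  note fin = less.prems(1-3) and heads = less.prems(5) and dem = less.prems(7)
  show ?case
  proof (cases "\<forall>k\<in>K. pos k = r")
    case True
    then show ?thesis
      by (intro exI[of _ "\<lambda>_. {}"]) (auto simp: disjoint_family_on_def)
  next
    case False
    then obtain k0 where k0: "k0 \<in> K" "pos k0 \<noteq> r"
      by blast
    define u where "u = pos k0"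
    have u: "u \<in> W"
      using less.prems(6)[OF k0(1)] k0(2) by (auto simp: u_def)
    define tight where
      "tight A \<longleftrightarrow> A \<subseteq> W \<and> u \<notin> A \<and> card {k \<in> K. pos k \<in> A} = card (out_arcs D A)" for A
    have "tight {}"
      by (simp add: tight_def out_arcs_def)
    moreover have "\<And>A. tight A \<Longrightarrow> card A \<le> card W"
      using fin by (auto simp: tight_def intro: card_mono)
    ultimately obtain M where M: "tight M" and max: "\<And>A. tight A \<Longrightarrow> card A \<le> card M"
      using ex_has_greatest_nat[of tight "{}" card "Suc (card W)"] by (auto simp: less_Suc_eq_le)
    have tight_subset: "A \<subseteq> M" if A: "tight A" for A
    proof -
      have "card {k \<in> K. pos k \<in> A \<union> M} \<le> card (out_arcs D (A \<union> M))"
        "card {k \<in> K. pos k \<in> A \<inter> M} \<le> card (out_arcs D (A \<inter> M))"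
        using dem A M unfolding tight_def meets_demand_def by blast+
      then have "card {k \<in> K. pos k \<in> A \<union> M} = card (out_arcs D (A \<union> M))"
        using A M card_tokens_modular[OF fin(2), of pos A M] out_arcs_submodular[OF fin(1), of A M]
        unfolding tight_def by linarith
      then have "tight (A \<union> M)"
        using A M by (auto simp: tight_def)
      then have "card (A \<union> M) \<le> card M"
        by (rule max)
      moreover have "finite (A \<union> M)"
        using A M fin by (auto simp: tight_def intro: finite_subset)
      ultimately have "M = A \<union> M"
        by (intro card_seteq) auto
      then show ?thesis by blast
    qed
    have "\<exists>e w. (u, e, w) \<in> D \<and> w \<notin> M"
    proof (rule ccontr)
      assume "\<not> ?thesis"
      then have "out_arcs D (insert u M) \<subseteq> out_arcs D M"
        by (auto simp: out_arcs_def)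
      then have "card (out_arcs D (insert u M)) \<le> card (out_arcs D M)"
        using fin by (intro card_mono finite_out_arcs)
      also have "\<dots> = card {k \<in> K. pos k \<in> M}"
        using M by (simp add: tight_def)
      also have "\<dots> < card {k \<in> K. pos k \<in> insert u M}"
        using fin k0 M by (intro psubset_card_mono) (auto simp: u_def tight_def)
      also have "\<dots> \<le> card (out_arcs D (insert u M))"
        using dem M u unfolding tight_def meets_demand_def by blast
      finally show False by simp
    qed
    then obtain e w where \<alpha>: "(u, e, w) \<in> D" "w \<notin> M"
      by blast
    define D' where "D' = D - {(u, e, w)}"
    define pos' where "pos' = pos(k0 := w)"
    have "meets_demand D' W K pos'"
      unfolding meets_demand_def
    proof (intro allI impI)
      fix A assume A: "A \<subseteq> W"
      have le: "card {k \<in> K. pos k \<in> A} \<le> card (out_arcs D A)"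
        using dem A by (auto simp: meets_demand_def)
      consider "u \<in> A" "w \<notin> A" | "u \<notin> A" "w \<in> A" | "u \<in> A \<longleftrightarrow> w \<in> A"
        by blast
      then show "card {k \<in> K. pos' k \<in> A} \<le> card (out_arcs D' A)"
      proof cases
        case 1
        have "{k \<in> K. pos' k \<in> A} = {k \<in> K. pos k \<in> A} - {k0}"
          using 1 by (auto simp: pos'_def)
        moreover have "k0 \<in> {k \<in> K. pos k \<in> A}" "(u, e, w) \<in> out_arcs D A"
          using 1 k0 \<alpha> by (auto simp: u_def out_arcs_def)
        ultimately show ?thesis
          using le by (simp add: D'_def out_arcs_remove)
      next
        case 2
        have "\<not> tight A"
          using tight_subset 2 \<alpha> by blast
        then have "card {k \<in> K. pos k \<in> A} < card (out_arcs D A)"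
          using le A 2 by (auto simp: tight_def)
        moreover have "{k \<in> K. pos' k \<in> A} \<subseteq> insert k0 {k \<in> K. pos k \<in> A}"
          by (auto simp: pos'_def)
        then have "card {k \<in> K. pos' k \<in> A} \<le> card (insert k0 {k \<in> K. pos k \<in> A})"
          using fin by (intro card_mono) auto
        moreover have "\<dots> \<le> Suc (card {k \<in> K. pos k \<in> A})"
          using fin by (simp add: card_insert_if)
        moreover have "out_arcs D' A = out_arcs D A"
          using 2 by (auto simp: D'_def out_arcs_def)
        ultimately show ?thesis by simp
      next
        case 3
        have "{k \<in> K. pos' k \<in> A} = {k \<in> K. pos k \<in> A}"
          using 3 by (auto simp: pos'_def u_def)
        moreover have "out_arcs D' A = out_arcs D A"
          using 3 by (auto simp: D'_def out_arcs_def)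
        ultimately show ?thesis
          using le by simp
      qed
    qed
    moreover have "card D' < card D"
      using \<alpha>(1) fin(1) card_Diff1_less unfolding D'_def by metis
    moreover have "pos' k \<in> insert r W" if "k \<in> K" for k
      using less.prems(6)[OF that] heads[OF \<alpha>(1)] by (simp add: pos'_def)
    moreover have "b \<in> insert r W" if "(a, f, b) \<in> D'" for a f b
      using heads that by (auto simp: D'_def)
    moreover have "finite D'"
      using fin by (simp add: D'_def)
    ultimately obtain B where
      B: "\<forall>k\<in>K. B k \<subseteq> D' \<and> (pos' k, r) \<in> (arc_step (B k))\<^sup>*" "disjoint_family_on B K"
      using less.hyps[of D' pos'] fin(2,3) less.prems(4) by blast
    define B' where "B' = B(k0 := insert (u, e, w) (B k0))"
    have "B' k \<subseteq> D \<and> (pos k, r) \<in> (arc_step (B' k))\<^sup>*" if k: "k \<in> K" for k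
    proof (cases "k = k0")
      case True
      have "(w, r) \<in> (arc_step (B' k0))\<^sup>*"
        using B(1) k0(1) rtrancl_mono[of "arc_step (B k0)" "arc_step (B' k0)"]
        by (fastforce simp: B'_def arc_step_def pos'_def)
      moreover have "(u, w) \<in> arc_step (B' k0)"
        by (auto simp: B'_def arc_step_def)
      ultimately show ?thesis
        using True B(1) k0(1) \<alpha> by (auto simp: B'_def D'_def u_def intro: converse_rtrancl_into_rtrancl)
    next
      case False
      then show ?thesis
        using k B(1) by (auto simp: B'_def D'_def pos'_def)
    qed
    moreover have "disjoint_family_on B' K"
      using B k0 unfolding disjoint_family_on_def B'_def D'_def by auto
    ultimately show ?thesis by blast
  qed
qed

definition edge_step :: "('v, 'e) graph \<Rightarrow> 'e set \<Rightarrow> ('v \<times> 'v) set" where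
  "edge_step G F = {(a, b). \<exists>e\<in>F. ends G e = {a, b}}"

lemma sym_edge_step: "sym (edge_step G F)"
  by (auto simp: sym_def edge_step_def insert_commute)

text \<open>Menger's theorem for edge-disjoint connections from prescribed sources to a common root. Only
  the edge sets of the connections are recorded: disjointness is a statement about edges, and paths
  can be extracted from a connected edge set later.\<close>

theorem edge_disjoint_connections:
  assumes G: "multigraph G" and "finite K" and r: "r \<in> verts G"
    and pos: "\<And>k. k \<in> K \<Longrightarrow> pos k \<in> verts G"
    and dem: "\<And>A. A \<subseteq> verts G - {r} \<Longrightarrow> card {k \<in> K. pos k \<in> A} \<le> card (cut G A)"
  shows "\<exists>F. (\<forall>k\<in>K. F k \<subseteq> edges G \<and> (pos k, r) \<in> (edge_step G (F k))\<^sup>*) \<and> disjoint_family_on F K"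
proof -
  define W where "W = verts G - {r}"
  define D0 where "D0 = {(a, e, b). e \<in> edges G \<and> ends G e = {a, b}}"
  have fin: "finite (verts G)" "finite (edges G)"
    using G by (auto simp: multigraph_def)
  have D0_sub: "D0 \<subseteq> verts G \<times> edges G \<times> verts G"
    using G by (auto simp: D0_def multigraph_def)
  then have finD0: "finite D0"
    using fin by (auto intro: finite_subset)
  have "meets_demand D0 W K pos"
    unfolding meets_demand_def
  proof (intro allI impI)
    fix A assume A: "A \<subseteq> W"
    have "cut G A \<subseteq> (\<lambda>\<alpha>. fst (snd \<alpha>)) ` out_arcs D0 A"
    proof
      fix e assume e: "e \<in> cut G A"
      then have "e \<in> edges G"
        by (simp add: cut_def)
      then obtain a b where ab: "ends G e = {a, b}" "a \<noteq> b"
        using multigraph_edgeE[OF G] by metis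
      then have "(a \<in> A) \<noteq> (b \<in> A)"
        using e card_ends_Int_eq_1 by (force simp: cut_def)
      then have "(a, e, b) \<in> out_arcs D0 A \<or> (b, e, a) \<in> out_arcs D0 A"
        using \<open>e \<in> edges G\<close> ab by (auto simp: out_arcs_def D0_def)
      then show "e \<in> (\<lambda>\<alpha>. fst (snd \<alpha>)) ` out_arcs D0 A"
        by force
    qed
    then have "card (cut G A) \<le> card (out_arcs D0 A)"
      using finD0 by (meson finite_out_arcs surj_card_le)
    then show "card {k \<in> K. pos k \<in> A} \<le> card (out_arcs D0 A)"
      using dem[of A] A by (simp add: W_def)
  qed
  then obtain D where D: "D \<subseteq> D0" "meets_demand D W K pos"
    and oriented: "\<And>a e b. (a, e, b) \<in> D \<Longrightarrow> (b, e, a) \<notin> D"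
    using exists_orientation_meeting_demand[OF finD0 \<open>finite K\<close>, of W pos] by blast
  have "\<exists>B. (\<forall>k\<in>K. B k \<subseteq> D \<and> (pos k, r) \<in> (arc_step (B k))\<^sup>*) \<and> disjoint_family_on B K"
  proof (rule tokens_walk_to_root[OF _ \<open>finite K\<close>])
    show "finite D" "finite W" "r \<notin> W"
      using D finD0 fin finite_subset by (auto simp: W_def)
    show "b \<in> insert r W" if "(a, e, b) \<in> D" for a e b
      using that D D0_sub by (auto simp: W_def)
  qed (use D pos in \<open>auto simp: W_def\<close>)
  then obtain B where B: "\<forall>k\<in>K. B k \<subseteq> D \<and> (pos k, r) \<in> (arc_step (B k))\<^sup>*"
    "disjoint_family_on B K"
    by blast
  \<comment> \<open>Each edge is used in one direction only, so disjoint arc sets have disjoint edge sets.\<close>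
  have unique_arc: "\<alpha> = \<beta>" if mem: "\<alpha> \<in> D" "\<beta> \<in> D" and same:  "fst (snd \<alpha>) = fst (snd \<beta>)" for \<alpha> \<beta>
  proof -
    obtain a e b a' b' where eq: "\<alpha> = (a, e, b)" "\<beta> = (a', e, b')"
      using same by (metis prod.collapse)
    then have "{a, b} = {a', b'}"
      using mem D by (auto simp: D0_def)
    then show ?thesis
      using eq mem oriented by (auto simp: doubleton_eq_iff)
  qed
  define F where "F k = (\<lambda>\<alpha>. fst (snd \<alpha>)) ` B k" for k
  have "F k \<subseteq> edges G \<and> (pos k, r) \<in> (edge_step G (F k))\<^sup>*" if k: "k \<in> K" for k
  proof -
    have "arc_step (B k) \<subseteq> edge_step G (F k)"
    proof (intro subrelI)
      fix a b assume "(a, b) \<in> arc_step (B k)"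
      then obtain e where e: "(a, e, b) \<in> B k"
        by (auto simp: arc_step_def)
      then have "(a, e, b) \<in> D0"
        using B(1) k D(1) by blast
      moreover have "e \<in> F k"
        using imageI[OF e, of "\<lambda>\<alpha>. fst (snd \<alpha>)"] by (simp add: F_def)
      ultimately show "(a, b) \<in> edge_step G (F k)"
        by (auto simp: edge_step_def D0_def)
    qed
    then have "(pos k, r) \<in> (edge_step G (F k))\<^sup>*"
      using B(1) k rtrancl_mono by blast
    moreover have "F k \<subseteq> edges G"
      using B(1) k D(1) D0_sub unfolding F_def by fastforce
    ultimately show ?thesis by blast
  qed
  moreover have "disjoint_family_on F K"
    unfolding disjoint_family_on_def F_def
  proof (intro ballI impI equals0I)
    fix k k' e assume k: "k \<in> K" "k' \<in> K" "k \<noteq> k'"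
      and "e \<in> (\<lambda>\<alpha>. fst (snd \<alpha>)) ` B k \<inter> (\<lambda>\<alpha>. fst (snd \<alpha>)) ` B k'"
    then obtain \<alpha> \<beta> where ab: "\<alpha> \<in> B k" "\<beta> \<in> B k'" "fst (snd \<alpha>) = fst (snd \<beta>)"
      by auto
    then have "\<alpha> = \<beta>"
      using B(1) k by (intro unique_arc) auto
    then show False
      using disjoint_family_onD[OF B(2) k] ab by auto
  qed
  ultimately show ?thesis by blast
qed

section \<open>Clique immersions\<close>

lemma path_graph_sym:
  assumes "path_graph P x y"
  shows "path_graph P y x"
proof -
  obtain vs es where *: "walk P vs es" "distinct vs" "hd vs = x" "last vs = y"
    "verts P = set vs" "edges P = set es"
    using assms by (auto simp: path_graph_def)
  have "walk P (rev vs) (rev es)"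
    unfolding walk_def
  proof (intro conjI allI impI)
    fix i assume "i < length (rev es)"
    moreover define j where "j = length es - Suc i"
    ultimately have j: "j < length es" "rev es ! i = es ! j" "rev vs ! i = vs ! Suc j"
      "rev vs ! Suc i = vs ! j"
      using *(1) by (auto simp: walk_def rev_nth Suc_diff_Suc)
    then show "ends P (rev es ! i) = {rev vs ! i, rev vs ! Suc i}"
      using *(1) by (auto simp: walk_def)
  qed (use *(1) in \<open>auto simp: walk_def\<close>)
  moreover have "vs \<noteq> []"
    using *(1) by (auto simp: walk_def)
  ultimately show ?thesis
    unfolding path_graph_def using *
    by (intro exI[of _ "rev vs"] exI[of _ "rev es"]) (auto simp: hd_rev last_rev)
qed

text \<open>A connection is followed edge by edge while maintaining a path; on returning to a vertex of the
  path, the path is cut back to that vertex.\<close>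

lemma connection_contains_path:
  assumes "(x, y) \<in> (edge_step G F)\<^sup>*" "x \<in> verts G" "F \<subseteq> edges G" "multigraph G"
  shows "\<exists>P. path_graph P x y \<and> subgraph P G \<and> edges P \<subseteq> F"
  using assms(1)
proof (induction rule: rtrancl_induct)
  case base
  have "path_graph (G\<lparr>verts := {x}, edges := {}\<rparr>) x x"
    unfolding path_graph_def by (intro exI[of _ "[x]"] exI[of _ "[]"]) (auto simp: walk_def)
  then show ?case
    using assms(2) by (intro exI[of _ "G\<lparr>verts := {x}, edges := {}\<rparr>"]) (auto simp: subgraph_def)
next
  case (step y z)
  then obtain P where P: "path_graph P x y" "subgraph P G" "edges P \<subseteq> F"
    by blast
  then obtain vs es where p: "walk P vs es" "distinct vs" "hd vs = x" "last vs = y"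
    "verts P = set vs" "edges P = set es"
    by (auto simp: path_graph_def)
  have len: "length vs = Suc (length es)"
    using p(1) by (simp add: walk_def)
  have edge: "ends G (es ! i) = {vs ! i, vs ! Suc i}" if "i < length es" for i
    using that p P(2) by (auto simp: walk_def subgraph_def)
  define H where "H us fs = G\<lparr>verts := set us, edges := set fs\<rparr>" for us fs
  show ?case
  proof (cases "z \<in> set vs")
    case True
    then obtain n where n: "n < length vs" "vs ! n = z"
      by (auto simp: in_set_conv_nth)
    have "walk (H (take (Suc n) vs) (take n es)) (take (Suc n) vs) (take n es)"
      using n len edge by (auto simp: walk_def H_def)
    moreover have "last (take (Suc n) vs) = z"
      using n by (simp add: take_Suc_conv_app_nth)
    moreover have "hd (take (Suc n) vs) = x"
      using p by simp
    ultimately have "path_graph (H (take (Suc n) vs) (take n es)) x z"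
      unfolding path_graph_def using p(2)
      by (intro exI[of _ "take (Suc n) vs"] exI[of _ "take n es"]) (auto simp: H_def)
    moreover have "subgraph (H (take (Suc n) vs) (take n es)) G"
      using P(2) p(5,6) set_take_subset[of "Suc n" vs] set_take_subset[of n es]
      by (auto simp: subgraph_def H_def)
    moreover have "edges (H (take (Suc n) vs) (take n es)) \<subseteq> F"
      using P(3) p(6) set_take_subset[of n es] by (auto simp: H_def)
    ultimately show ?thesis by blast
  next
    case False
    obtain e where e: "e \<in> F" "ends G e = {y, z}"
      using step by (auto simp: edge_step_def)
    have ez: "e \<in> edges G" "z \<in> verts G"
      using e assms(3,4) by (auto simp: multigraph_def)
    have last: "vs ! length es = y"
      using p(4) len by (metis diff_Suc_1 last_conv_nth length_0_conv nat.distinct(1))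
    have "walk (H (vs @ [z]) (es @ [e])) (vs @ [z]) (es @ [e])"
      using len edge e last by (auto simp: walk_def H_def nth_append less_Suc_eq)
    moreover have "hd (vs @ [z]) = x"
      using p(3) len by (cases vs) auto
    ultimately have "path_graph (H (vs @ [z]) (es @ [e])) x z"
      unfolding path_graph_def using p(2) False
      by (intro exI[of _ "vs @ [z]"] exI[of _ "es @ [e]"]) (auto simp: H_def)
    moreover have "subgraph (H (vs @ [z]) (es @ [e])) G"
      using P(2) p(5,6) ez by (auto simp: subgraph_def H_def)
    moreover have "edges (H (vs @ [z]) (es @ [e])) \<subseteq> F"
      using P(3) p(6) e by (auto simp: H_def)
    ultimately show ?thesis by blast
  qed
qed

text \<open>An immersion must provide a path for either orientation of an edge of the clique; one path
  serves both because reversing a path does not change its graph.\<close>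

lemma clique_immersion_of_edge_sets:
  assumes G: "multigraph G"
    and \<phi>: "inj_on \<phi> {..<t}" "\<phi> ` {..<t} \<subseteq> verts G"
    and F: "\<And>f. f \<in> edges (complete_graph t) \<Longrightarrow> F f \<subseteq> edges G"
    and disj: "disjoint_family_on F (edges (complete_graph t))"
    and conn: "\<And>i j. i < j \<Longrightarrow> j < t \<Longrightarrow> (\<phi> i, \<phi> j) \<in> (edge_step G (F {i, j}))\<^sup>*"
  shows "admits_weak_immersion G (complete_graph t)"
proof -
  have "\<exists>P. subgraph P G \<and> edges P \<subseteq> F f \<and> (\<forall>x y. f = {x, y} \<longrightarrow> path_graph P (\<phi> x) (\<phi> y))"
    if f: "f \<in> edges (complete_graph t)" for f
  proof -
    obtain x y where xy: "f = {x, y}" "x \<noteq> y" "x < t" "y < t"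
      using f by (auto simp: complete_graph_def card_2_iff)
    \<comment> \<open>The connections are given for ordered pairs only.\<close>
    define i j where "i = min x y" and "j = max x y"
    have ij: "f = {i, j}" "i < j" "j < t"
      using xy by (auto simp: i_def j_def min_def max_def)
    have "(\<phi> i, \<phi> j) \<in> (edge_step G (F f))\<^sup>*"
      using conn ij by simp
    moreover have "\<phi> i \<in> verts G"
      using \<phi>(2) ij by auto
    ultimately obtain P where P: "path_graph P (\<phi> i) (\<phi> j)" "subgraph P G" "edges P \<subseteq> F f"
      using connection_contains_path F[OF f] G by metis
    then have "\<forall>x y. f = {x, y} \<longrightarrow> path_graph P (\<phi> x) (\<phi> y)"
      using ij path_graph_sym by (auto simp: doubleton_eq_iff)
    then show ?thesis
      using P by blast
  qed
  then obtain \<pi>e where \<pi>e: "\<And>f. f \<in> edges (complete_graph t) \<Longrightarrow>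
      subgraph (\<pi>e f) G \<and> edges (\<pi>e f) \<subseteq> F f \<and> (\<forall>x y. f = {x, y} \<longrightarrow> path_graph (\<pi>e f) (\<phi> x) (\<phi> y))"
    by metis
  have "edges (\<pi>e f) \<inter> edges (\<pi>e f') = {}"
    if "f \<in> edges (complete_graph t)" "f' \<in> edges (complete_graph t)" "f \<noteq> f'" for f f'
    using \<pi>e[OF that(1)] \<pi>e[OF that(2)] disjoint_family_onD[OF disj that] by blast
  then have "weak_immersion G (complete_graph t) \<phi> \<pi>e"
    unfolding weak_immersion_def using \<phi> \<pi>e by (auto simp: complete_graph_def)
  then show ?thesis
    by (auto simp: admits_weak_immersion_def)
qed

text \<open>The vertices are numbered \<open>\<phi> 0, \<dots>, \<phi> n\<close>, with hub \<open>\<phi> n\<close>, and every other \<open>\<phi> i\<close> has \<open>n\<close>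
  connections \<open>(i, 0), \<dots>, (i, n - 1)\<close> to the hub. The clique edge between two non-hub vertices
  \<open>i\<close> and \<open>j\<close> uses the connections \<open>(i, j)\<close> and \<open>(j, i)\<close>. Connection \<open>(i, i)\<close> is then still free,
  and it serves the clique edge between \<open>i\<close> and the hub. Since \<open>n \<times> n\<close> tokens are placed in total,
  any cut with at least \<open>n * n\<close> edges meets the demand.\<close>

theorem clique_immersion_of_highly_connected_set:
  assumes G: "multigraph G" and S: "S \<subseteq> verts G" "card S = Suc n"
    and conn: "\<And>A u v. A \<subseteq> verts G \<Longrightarrow> u \<in> S \<Longrightarrow> v \<in> S \<Longrightarrow> u \<in> A \<Longrightarrow> v \<notin> A \<Longrightarrow> n * n \<le> card (cut G A)"
  shows "admits_weak_immersion G (complete_graph (Suc n))"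
proof -
  have "finite S"
    using S by (auto intro: card_ge_0_finite)
  then obtain \<phi> where \<phi>: "bij_betw \<phi> {..<Suc n} S"
    using S(2) ex_bij_betw_nat_finite[of S] by (auto simp: atLeast0LessThan)
  then have inj: "inj_on \<phi> {..<Suc n}" and \<phi>S: "\<And>i. i \<le> n \<Longrightarrow> \<phi> i \<in> S"
    by (auto simp: bij_betw_def)
  define r where "r = \<phi> n"
  define K where "K = {..<n} \<times> {..<n}"
  have "\<exists>F. (\<forall>k\<in>K. F k \<subseteq> edges G \<and> (\<phi> (fst k), r) \<in> (edge_step G (F k))\<^sup>*) \<and> disjoint_family_on F K"
  proof (rule edge_disjoint_connections[OF G])
    show "finite K" "r \<in> verts G"
      using \<phi>S S(1) by (auto simp: K_def r_def)
    show "\<phi> (fst k) \<in> verts G" if "k \<in> K" for k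
      using that \<phi>S[of "fst k"] S(1) by (auto simp: K_def)
    fix A assume A: "A \<subseteq> verts G - {r}"
    show "card {k \<in> K. \<phi> (fst k) \<in> A} \<le> card (cut G A)"
    proof (cases "{k \<in> K. \<phi> (fst k) \<in> A} = {}")
      case False
      then obtain i where i: "i < n" "\<phi> i \<in> A"
        by (auto simp: K_def)
      have "card {k \<in> K. \<phi> (fst k) \<in> A} \<le> card K"
        by (intro card_mono) (auto simp: K_def)
      also have "\<dots> = n * n"
        by (simp add: K_def card_cartesian_product)
      also have "\<dots> \<le> card (cut G A)"
        using conn[of A "\<phi> i" r] A i \<phi>S by (auto simp: r_def)
      finally show ?thesis .
    next
      case True
      then show ?thesis by (simp only: card.empty)
    qed
  qed
  then obtain F where F: "\<And>k. k \<in> K \<Longrightarrow> F k \<subseteq> edges G"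
    "\<And>k. k \<in> K \<Longrightarrow> (\<phi> (fst k), r) \<in> (edge_step G (F k))\<^sup>*" and disj: "disjoint_family_on F K"
    by blast
  define key where "key i j = (i, if j = n then i else j)" for i j :: nat
  have key_K: "key i j \<in> K" if "i < n" "j \<le> n" for i j
    using that by (auto simp: key_def K_def)
  define H where "H f = \<Union>{F (key i j) | i j. f = {i, j} \<and> i \<noteq> j \<and> i < n \<and> j \<le> n}" for f
  show ?thesis
  proof (rule clique_immersion_of_edge_sets[OF G inj])
    show "\<phi> ` {..<Suc n} \<subseteq> verts G"
      using \<phi>S S(1) by auto
    show "H f \<subseteq> edges G" for f
    proof
      fix e assume "e \<in> H f"
      then obtain i j where "e \<in> F (key i j)" "i < n" "j \<le> n"
        unfolding H_def by blast
      then show "e \<in> edges G"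
        using F(1)[OF key_K] by blast
    qed
    have "f = f'" if e: "e \<in> H f" "e \<in> H f'" for e f f'
    proof -
      obtain i j where ij: "e \<in> F (key i j)" "f = {i, j}" "i \<noteq> j" "i < n" "j \<le> n"
        using e(1) unfolding H_def by blast
      obtain i' j' where ij': "e \<in> F (key i' j')" "f' = {i', j'}" "i' \<noteq> j'" "i' < n" "j' \<le> n"
        using e(2) unfolding H_def by blast
      have "key i j = key i' j'"
        using disjoint_family_onD[OF disj, of "key i j" "key i' j'"] ij ij' key_K by blast
      then have "i = i'" "j = j'"
        using ij ij' by (auto simp: key_def split: if_splits)
      then show ?thesis
        using ij ij' by simp
    qed
    then show "disjoint_family_on H (edges (complete_graph (Suc n)))"
      unfolding disjoint_family_on_def by blast
    fix i j assume ij: "i < j" "j < Suc n"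
    have to_root: "(\<phi> i', r) \<in> (edge_step G (H {i', j'}))\<^sup>*" if "i' \<noteq> j'" "i' < n" "j' \<le> n" for i' j'
    proof -
      have "F (key i' j') \<subseteq> H {i', j'}"
        using that unfolding H_def by blast
      then have "edge_step G (F (key i' j')) \<subseteq> edge_step G (H {i', j'})"
        by (auto simp: edge_step_def)
      moreover have "(\<phi> i', r) \<in> (edge_step G (F (key i' j')))\<^sup>*"
        using F(2)[OF key_K[OF that(2,3)]] by (simp add: key_def)
      ultimately show ?thesis
        using rtrancl_mono by blast
    qed
    show "(\<phi> i, \<phi> j) \<in> (edge_step G (H {i, j}))\<^sup>*"
    proof (cases "j = n")
      case True
      then show ?thesis
        using to_root[of i j] ij by (simp add: r_def)
    next
      case False
      then have "(\<phi> j, r) \<in> (edge_step G (H {i, j}))\<^sup>*"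
        using to_root[of j i] ij by (simp add: insert_commute)
      then have "(r, \<phi> j) \<in> (edge_step G (H {i, j}))\<^sup>*"
        by (rule symD[OF sym_rtrancl[OF sym_edge_step]])
      then show ?thesis
        using to_root[of i j] ij by (auto elim: rtrancl_trans)
    qed
  qed
qed

section \<open>A laminar family of minimum cuts\<close>

definition laminar :: "'v set set \<Rightarrow> bool" where
  "laminar L \<longleftrightarrow> (\<forall>A\<in>L. \<forall>B\<in>L. A \<subseteq> B \<or> B \<subseteq> A \<or> A \<inter> B = {})"

definition separates :: "'v set \<Rightarrow> 'v \<Rightarrow> 'v \<Rightarrow> bool" where
  "separates A u v \<longleftrightarrow> (u \<in> A) \<noteq> (v \<in> A)"

definition crosses :: "'v set \<Rightarrow> 'v set \<Rightarrow> bool" where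
  "crosses A B \<longleftrightarrow> \<not> (A \<subseteq> B \<or> B \<subseteq> A \<or> A \<inter> B = {})"

definition min_cut :: "('v, 'e) graph \<Rightarrow> 'v \<Rightarrow> 'v \<Rightarrow> 'v set \<Rightarrow> bool" where
  "min_cut G u v A \<longleftrightarrow> A \<subseteq> verts G \<and> separates A u v \<and>
     (\<forall>C\<subseteq>verts G. separates C u v \<longrightarrow> card (cut G A) \<le> card (cut G C))"

text \<open>Let \<open>p \<in> B\<close> and \<open>q \<notin> B\<close> be the two vertices for which \<open>B\<close> is a minimum cut. Since \<open>u\<close> and \<open>v\<close>
  are on the same side of \<open>B\<close>, two of the four sets separate them: \<open>A \<inter> B\<close> and \<open>B - A\<close> if that side
  is \<open>B\<close>, and \<open>A \<union> B\<close> and \<open>A - B\<close> otherwise. The submodular inequality pairs \<open>A \<union> B\<close> with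
  \<open>A \<inter> B\<close>, and the posimodular one pairs \<open>A - B\<close> with \<open>B - A\<close>. In one of these two pairs one
  set separates \<open>u\<close> from \<open>v\<close> while its partner separates \<open>p\<close> from \<open>q\<close>. The partner has at least as
  many cut edges as \<open>B\<close>, so the set itself has at most as many as \<open>A\<close>.\<close>

lemma uncross_min_cuts:
  assumes G: "multigraph G" and A: "min_cut G u v A" and B: "min_cut G x y B"
    and "\<not> separates B u v"
  shows "\<exists>A'\<in>{A \<union> B, A \<inter> B, A - B, B - A}. min_cut G u v A'"
proof -
  have sub: "A \<subseteq> verts G" "B \<subseteq> verts G"
    using A B by (auto simp: min_cut_def)
  have A_le: "card (cut G A) \<le> card (cut G C)" if "C \<subseteq> verts G" "separates C u v" for C
    using A that by (auto simp: min_cut_def)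
  have B_le: "card (cut G B) \<le> card (cut G C)" if "C \<subseteq> verts G" "separates C x y" for C
    using B that by (auto simp: min_cut_def)
  have swap: "min_cut G u v A'"
    if "A' \<subseteq> verts G" "B' \<subseteq> verts G" "separates A' u v" "separates B' x y"
      "card (cut G A') + card (cut G B') \<le> card (cut G A) + card (cut G B)" for A' B'
  proof -
    have "card (cut G A') \<le> card (cut G A)"
      using that B_le[of B'] by linarith
    then show ?thesis
      using that A_le unfolding min_cut_def by (meson le_trans)
  qed
  note submod = cut_submodular[OF G, of A B] and posimod = cut_posimodular[OF G sub]
  have uv: "separates A u v" "u \<in> B \<longleftrightarrow> v \<in> B" and xy: "(x \<in> B) \<noteq> (y \<in> B)"
    using A B assms(4) by (auto simp: min_cut_def separates_def)
  obtain p q where pq: "p \<in> B" "q \<notin> B" "{p, q} = {x, y}"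
    using xy by blast
  then have sep_iff: "separates C x y \<longleftrightarrow> separates C p q" for C
    by (auto simp: separates_def doubleton_eq_iff)
  show ?thesis
  proof (cases "u \<in> B")
    case True
    show ?thesis
    proof (cases "q \<in> A")
      case q: True
      have "min_cut G u v (B - A)"
        using True uv q pq sub posimod by (intro swap[of "B - A" "A - B"]) (auto simp: sep_iff separates_def)
      then show ?thesis by blast
    next
      case q: False
      have "min_cut G u v (A \<inter> B)"
        using True uv q pq sub submod by (intro swap[of "A \<inter> B" "A \<union> B"]) (auto simp: sep_iff separates_def)
      then show ?thesis by blast
    qed
  next
    case False
    show ?thesis
    proof (cases "p \<in> A")
      case p: True
      have "min_cut G u v (A \<union> B)"
        using False uv p pq sub submod by (intro swap[of "A \<union> B" "A \<inter> B"]) (auto simp: sep_iff separates_def)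
      then show ?thesis by blast
    next
      case p: False
      have "min_cut G u v (A - B)"
        using False uv p pq sub posimod by (intro swap[of "A - B" "B - A"]) (auto simp: sep_iff separates_def)
      then show ?thesis by blast
    qed
  qed
qed

text \<open>Uncrossing with a member \<open>B\<close> of a laminar family creates no crossing with another member \<open>C\<close>, so
  it strictly decreases the number of members that are crossed.\<close>

lemma crosses_uncrossed:
  assumes "crosses A B" "\<not> crosses B C" "crosses A' C" "A' \<in> {A \<union> B, A \<inter> B, A - B, B - A}"
  shows "crosses A C"
proof (rule ccontr)
  assume "\<not> crosses A C"
  then have AC: "A \<subseteq> C \<or> C \<subseteq> A \<or> A \<inter> C = {}" and BC: "B \<subseteq> C \<or> C \<subseteq> B \<or> B \<inter> C = {}"
    using assms(2) by (auto simp: crosses_def)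
  obtain a b c where "a \<in> A - B" "b \<in> B - A" "c \<in> A \<inter> B"
    using assms(1) unfolding crosses_def by blast
  moreover obtain a' b' c' where "a' \<in> A' - C" "b' \<in> C - A'" "c' \<in> A' \<inter> C"
    using assms(3) unfolding crosses_def by blast
  moreover note assms(4)
  ultimately show False
    using AC BC by (elim disjE insertE) (simp_all, blast+)
qed

lemma exists_min_cut:
  assumes G: "multigraph G" and "C \<subseteq> verts G" "separates C u v" "u \<in> verts G" "v \<in> verts G"
  shows "\<exists>A. min_cut G u v A \<and> r \<notin> A \<and> card (cut G A) \<le> card (cut G C)"
proof -
  define P where "P A \<longleftrightarrow> A \<subseteq> verts G \<and> separates A u v" for A
  have "P C"
    using assms by (simp add: P_def)
  then obtain A where A: "P A" "\<And>C. P C \<Longrightarrow> card (cut G A) \<le> card (cut G C)"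
    using ex_has_least_nat[of P C "\<lambda>C. card (cut G C)"] by blast
  then have A_min: "min_cut G u v A"
    by (auto simp: min_cut_def P_def)
  then have "min_cut G u v (verts G - A)"
    using assms(4,5) by (auto simp: min_cut_def separates_def cut_complement[OF G])
  then show ?thesis
    using A_min A(2)[OF \<open>P C\<close>] cut_complement[OF G, of A]
    by (cases "r \<in> A") (auto intro: exI[of _ A] exI[of _ "verts G - A"])
qed

text \<open>All members are chosen to avoid a fixed vertex \<open>r\<close>: replacing a set by its complement does not
  change its cut, and fixing the side in this way lets laminarity of the sets express that the cuts
  do not cross. Each member is required to be a minimum cut for some pair, since
  this is what \<open>uncross_min_cuts\<close> needs.\<close>

theorem exists_laminar_separating_family:
  assumes G: "multigraph G"
  shows "\<exists>L. laminar L \<and> (\<forall>A\<in>L. A \<noteq> {} \<and> A \<subset> verts G \<and> card (cut G A) < k) \<and>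
    (\<forall>u\<in>verts G. \<forall>v\<in>verts G. \<forall>C\<subseteq>verts G. separates C u v \<longrightarrow> card (cut G C) < k \<longrightarrow>
       (\<exists>A\<in>L. separates A u v))"
proof (cases "verts G = {}")
  case True
  then show ?thesis
    by (intro exI[of _ "{}"]) (auto simp: laminar_def)
next
  case False
  then obtain r where r: "r \<in> verts G"
    by blast
  have finV: "finite (verts G)"
    using G by (simp add: multigraph_def)
  define P where "P L \<longleftrightarrow> laminar L \<and>
    (\<forall>A\<in>L. r \<notin> A \<and> card (cut G A) < k \<and> (\<exists>x y. min_cut G x y A))" for L
  have P_sub: "L \<subseteq> Pow (verts G)" if "P L" for L
    using that by (auto simp: P_def min_cut_def)
  have "P {}"
    by (simp add: P_def laminar_def)
  moreover have "card L \<le> card (Pow (verts G))" if "P L" for L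
    using P_sub[OF that] finV by (intro card_mono) auto
  ultimately obtain L where L: "P L" and max: "\<And>L'. P L' \<Longrightarrow> card L' \<le> card L"
    using ex_has_greatest_nat[of P "{}" card "Suc (card (Pow (verts G)))"] by (auto simp: less_Suc_eq_le)
  have finL: "finite L"
    using P_sub[OF L] finV by (auto intro: finite_subset)
  have "\<exists>A\<in>L. separates A u v"
    if uv: "u \<in> verts G" "v \<in> verts G" and C: "C \<subseteq> verts G" "separates C u v" "card (cut G C) < k"
    for u v C
  proof (rule ccontr)
    assume no_sep: "\<not> ?thesis"
    \<comment> \<open>Among the minimum cuts for \<open>u\<close> and \<open>v\<close>, one that crosses the fewest members of \<open>L\<close> crosses
      none of them, so it could be added to \<open>L\<close>.\<close>
    define Q where "Q A \<longleftrightarrow> min_cut G u v A \<and> r \<notin> A" for A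
    obtain A0 where A0: "Q A0"
      using exists_min_cut[OF G C(1,2) uv] by (auto simp: Q_def)
    then obtain A where A: "Q A"
      and least: "\<And>A'. Q A' \<Longrightarrow> card {B \<in> L. crosses A B} \<le> card {B \<in> L. crosses A' B}"
      using ex_has_least_nat[of Q A0 "\<lambda>A. card {B \<in> L. crosses A B}"] by blast
    have "\<not> crosses A B" if B: "B \<in> L" for B
    proof
      assume cross: "crosses A B"
      obtain x y where "min_cut G x y B"
        using B L by (auto simp: P_def)
      then obtain A' where A': "A' \<in> {A \<union> B, A \<inter> B, A - B, B - A}" "min_cut G u v A'"
        using uncross_min_cuts[OF G, of u v A x y B] A no_sep B by (auto simp: Q_def)
      then have "Q A'"
        using A B L by (auto simp: Q_def P_def)
      have "\<not> crosses A' B"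
        using A'(1) by (auto simp: crosses_def)
      moreover have "crosses A C" if "C \<in> L" "crosses A' C" for C
      proof (rule crosses_uncrossed[OF cross _ that(2) A'(1)])
        show "\<not> crosses B C"
          using L B that(1) by (auto simp: P_def laminar_def crosses_def)
      qed
      ultimately have "{C \<in> L. crosses A' C} \<subset> {C \<in> L. crosses A C}"
        using B cross by blast
      then have "card {C \<in> L. crosses A' C} < card {C \<in> L. crosses A C}"
        using finL by (intro psubset_card_mono) auto
      then show False
        using least[OF \<open>Q A'\<close>] by simp
    qed
    then have "laminar (insert A L)"
      using L unfolding P_def laminar_def crosses_def by blast
    moreover have "card (cut G A) < k"
      using A C by (auto simp: Q_def min_cut_def)
    ultimately have "P (insert A L)"
      using L A by (auto simp: P_def Q_def)
    then have "card (insert A L) \<le> card L"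
      by (rule max)
    moreover have "A \<notin> L"
      using A no_sep by (auto simp: Q_def min_cut_def)
    ultimately show False
      using finL by simp
  qed
  moreover have "A \<noteq> {} \<and> A \<subset> verts G \<and> card (cut G A) < k" if "A \<in> L" for A
    using L that r by (auto simp: P_def min_cut_def separates_def)
  moreover have "laminar L"
    using L by (simp add: P_def)
  ultimately show ?thesis
    by blast
qed

section \<open>The tree of a laminar family\<close>

definition adj :: "('v, 'e) graph \<Rightarrow> ('v \<times> 'v) set" where
  "adj H = {(a, b). a \<in> verts H \<and> b \<in> verts H \<and> (\<exists>e\<in>edges H. ends H e = {a, b})}"

lemma sym_adj: "sym (adj H)"
  by (auto simp: sym_def adj_def insert_commute)

lemma component_eq_reachable:
  assumes v: "v \<in> verts H"
  shows "component H v = {w. (v, w) \<in> (adj H)\<^sup>*}"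
proof (intro equalityI subsetI)
  fix w assume "w \<in> component H v"
  then obtain vs es where w: "walk H vs es" "hd vs = v" "last vs = w"
    by (auto simp: component_def)
  have len: "length vs = Suc (length es)"
    using w(1) by (simp add: walk_def)
  have "(vs ! 0, vs ! i) \<in> (adj H)\<^sup>*" if "i < length vs" for i
    using that
  proof (induction i)
    case (Suc i)
    have "vs ! i \<in> verts H" "vs ! Suc i \<in> verts H" "es ! i \<in> edges H"
      "ends H (es ! i) = {vs ! i, vs ! Suc i}"
      using w(1) Suc.prems nth_mem[of i vs] nth_mem[of "Suc i" vs] nth_mem[of i es]
      by (auto simp: walk_def)
    then have "(vs ! i, vs ! Suc i) \<in> adj H"
      by (auto simp: adj_def)
    then show ?case
      using Suc by (auto intro: rtrancl_into_rtrancl)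
  qed simp
  from this[of "length es"] show "w \<in> {w. (v, w) \<in> (adj H)\<^sup>*}"
    using w len hd_conv_nth[of vs] last_conv_nth[of vs] by fastforce
next
  fix w assume "w \<in> {w. (v, w) \<in> (adj H)\<^sup>*}"
  then have "(v, w) \<in> (adj H)\<^sup>*"
    by simp
  then show "w \<in> component H v"
  proof (induction rule: rtrancl_induct)
    case base
    have "walk H [v] []"
      using v by (simp add: walk_def)
    then show ?case
      unfolding component_def by (intro CollectI exI[of _ "[v]"] exI[of _ "[]"]) simp
  next
    case (step y z)
    then obtain vs es where w: "walk H vs es" "hd vs = v" "last vs = y"
      by (auto simp: component_def)
    obtain e where e: "e \<in> edges H" "ends H e = {y, z}" "z \<in> verts H"
      using step by (auto simp: adj_def)
    have len: "length vs = Suc (length es)"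
      using w(1) by (simp add: walk_def)
    then have "vs ! length es = y"
      using w(3) last_conv_nth[of vs] by fastforce
    then have "walk H (vs @ [z]) (es @ [e])"
      using w(1) e by (auto simp: walk_def nth_append less_Suc_eq)
    then show ?case
      unfolding component_def using w(2) len
      by (intro CollectI exI[of _ "vs @ [z]"] exI[of _ "es @ [e]"]) (cases vs, auto)
  qed
qed

lemma component_eqI:
  assumes "S \<subseteq> verts H" "v \<in> S"
    and closed: "\<And>e a b. e \<in> edges H \<Longrightarrow> ends H e = {a, b} \<Longrightarrow> a \<in> S \<Longrightarrow> b \<in> S"
    and root: "\<And>w. w \<in> S \<Longrightarrow> (w, root) \<in> (adj H)\<^sup>*"
  shows "component H v = S"
proof -
  have "w \<in> S" if "(v, w) \<in> (adj H)\<^sup>*" for w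
    using that
  proof (induction rule: rtrancl_induct)
    case (step y z)
    then show ?case
      using closed by (auto simp: adj_def)
  qed (rule assms)
  moreover have "(v, w) \<in> (adj H)\<^sup>*" if "w \<in> S" for w
    using root[OF assms(2)] root[OF that] symD[OF sym_rtrancl[OF sym_adj[of H]]]
    by (blast intro: rtrancl_trans)
  ultimately show ?thesis
    using component_eq_reachable[of v H] assms by auto
qed

text \<open>A closed walk that uses \<open>f\<close> only once leaves \<open>D\<close> through \<open>f\<close> and cannot come back, since no other
  edge joins \<open>D\<close> to its complement.\<close>

lemma no_cycle_through_bridge:
  assumes cyc: "cycle T vs es" "f \<in> set es"
    and f: "ends T f = {a, b}" "a \<in> D" "b \<notin> D"
    and other: "\<And>e x y. e \<in> edges T \<Longrightarrow> e \<noteq> f \<Longrightarrow> ends T e = {x, y} \<Longrightarrow> x \<in> D \<longleftrightarrow> y \<in> D"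
  shows False
proof -
  have walk: "walk T vs es" and dist: "distinct es" and closed: "hd vs = last vs"
    using cyc by (auto simp: cycle_def)
  have len: "length vs = Suc (length es)"
    using walk by (simp add: walk_def)
  obtain i where i: "i < length es" "es ! i = f"
    using cyc(2) by (auto simp: in_set_conv_nth)
  have stay: "vs ! j \<in> D \<longleftrightarrow> vs ! Suc j \<in> D" if "j < length es" "j \<noteq> i" for j
  proof (rule other)
    show "es ! j \<in> edges T" "ends T (es ! j) = {vs ! j, vs ! Suc j}"
      using walk that by (auto simp: walk_def)
    show "es ! j \<noteq> f"
      using i that dist nth_eq_iff_index_eq by metis
  qed
  have before: "vs ! 0 \<in> D \<longleftrightarrow> vs ! j \<in> D" if "j \<le> i" for j
    using that stay i by (induction j) auto
  have after: "vs ! Suc i \<in> D \<longleftrightarrow> vs ! j \<in> D" if "Suc i \<le> j" "j \<le> length es" for j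
    using that by (induction j rule: dec_induct) (use stay in auto)
  have "ends T f = {vs ! i, vs ! Suc i}"
    using walk i by (auto simp: walk_def)
  then have "(vs ! i \<in> D) \<noteq> (vs ! Suc i \<in> D)"
    using f by (auto simp: doubleton_eq_iff)
  moreover have "vs ! 0 = vs ! length es"
    using closed len hd_conv_nth[of vs] last_conv_nth[of vs] by fastforce
  ultimately show False
    using before[of i] after[of "length es"] i by auto
qed

text \<open>A laminar family that contains its ground set, indexed injectively. The indices become the tree
  nodes, which makes the node type free to choose. Only the root may have the empty set, which covers
  the graph without vertices.\<close>

locale laminar_index =
  fixes V :: "'v set" and I :: "'s set" and h :: "'s \<Rightarrow> 'v set" and root :: 's
  assumes finite_index: "finite I" and finite_ground: "finite V"
    and inj_h: "inj_on h I" and laminar_h: "laminar (h ` I)"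
    and root_index: "root \<in> I" and h_root: "h root = V"
    and h_subset: "i \<in> I \<Longrightarrow> h i \<subseteq> V"
    and h_nonempty: "i \<in> I \<Longrightarrow> i \<noteq> root \<Longrightarrow> h i \<noteq> {}"
begin

lemma finite_h: "i \<in> I \<Longrightarrow> finite (h i)"
  using h_subset finite_ground finite_subset by blast

lemma nested_if_common:
  assumes "i \<in> I" "j \<in> I" "x \<in> h i" "x \<in> h j"
  shows "h i \<subseteq> h j \<or> h j \<subseteq> h i"
  using laminar_h assms unfolding laminar_def by blast

definition parent :: "'s \<Rightarrow> 's" where
  "parent i = arg_min_on (\<lambda>j. card (h j)) {j \<in> I. h i \<subset> h j}"

lemma parent:
  assumes i: "i \<in> I" "i \<noteq> root"
  shows parent_index: "parent i \<in> I" and h_parent: "h i \<subset> h (parent i)"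
    and parent_least: "k \<in> I \<Longrightarrow> h i \<subset> h k \<Longrightarrow> h (parent i) \<subseteq> h k"
proof -
  let ?U = "{j \<in> I. h i \<subset> h j}"
  have "h i \<noteq> h root"
    using i root_index inj_h by (auto dest: inj_onD)
  then have "root \<in> ?U"
    using h_subset[OF i(1)] root_index h_root by auto
  then have U: "finite ?U" "?U \<noteq> {}"
    using finite_index by auto
  then have p: "parent i \<in> ?U"
    using arg_min_if_finite(1)[of ?U "\<lambda>j. card (h j)"] by (simp add: parent_def)
  then show "parent i \<in> I" "h i \<subset> h (parent i)"
    by auto
  have least: "\<not> card (h k) < card (h (parent i))" if "k \<in> ?U" for k
    using arg_min_if_finite(2)[OF U, of "\<lambda>j. card (h j)"] that by (auto simp: parent_def)
  assume k: "k \<in> I" "h i \<subset> h k"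
  obtain x where "x \<in> h i"
    using h_nonempty[OF i] by blast
  then have "h k \<subseteq> h (parent i) \<or> h (parent i) \<subseteq> h k"
    using nested_if_common[of k "parent i" x] k p by auto
  moreover have "\<not> h k \<subset> h (parent i)"
    using least[of k] k psubset_card_mono[OF finite_h[of "parent i"], of "h k"] p by auto
  ultimately show "h (parent i) \<subseteq> h k"
    by auto
qed

text \<open>The nodes of the subtree below \<open>i\<close>, described by inclusion instead of by iterating \<open>parent\<close>.\<close>

definition down :: "'s \<Rightarrow> 's set" where
  "down i = {j \<in> I. h j \<subseteq> h i}"

definition bag :: "'s \<Rightarrow> 'v set" where
  "bag i = h i - \<Union>{h j | j. j \<in> I \<and> h j \<subset> h i}"

text \<open>Every node other than the root doubles as the name of the edge to its parent.\<close>

definition tree_graph :: "('s, 's) graph" where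
  "tree_graph = \<lparr>verts = I, edges = I - {root}, ends = (\<lambda>i. {i, parent i})\<rparr>"

lemma down_subset: "down i \<subseteq> I"
  by (auto simp: down_def)

lemma self_in_down: "i \<in> I \<Longrightarrow> i \<in> down i"
  by (simp add: down_def)

lemma root_notin_down: "i \<in> I \<Longrightarrow> i \<noteq> root \<Longrightarrow> root \<notin> down i"
  using h_parent[of i] parent_index[of i] h_subset[of "parent i"] h_root by (auto simp: down_def)

text \<open>The edge from \<open>i\<close> to its parent is the only tree edge that joins \<open>down i\<close> to its complement.\<close>

lemma parent_in_down_iff:
  assumes "i \<in> I" "j \<in> I" "j \<noteq> root" "j \<noteq> i"
  shows "parent j \<in> down i \<longleftrightarrow> j \<in> down i"
proof -
  have "h j \<noteq> h i"
    using assms inj_h by (auto dest: inj_onD)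
  then show ?thesis
    using h_parent[of j] parent_index[of j] parent_least[of j i] assms by (auto simp: down_def)
qed

lemma parent_notin_down: "i \<in> I \<Longrightarrow> i \<noteq> root \<Longrightarrow> parent i \<notin> down i"
  using h_parent[of i] by (auto simp: down_def)

lemma climb_to:
  assumes "S \<subseteq> I"
    and step: "\<And>j. j \<in> S \<Longrightarrow> j \<noteq> a \<Longrightarrow> j \<noteq> root \<and> parent j \<in> S \<and> (j, parent j) \<in> R"
    and "j \<in> S"
  shows "(j, a) \<in> R\<^sup>*"
  using \<open>j \<in> S\<close>
proof (induction "card V - card (h j)" arbitrary: j rule: less_induct)
  case less
  show ?case
  proof (cases "j = a")
    case False
    note s = step[OF less.prems False]
    have j: "j \<in> I" "j \<noteq> root"
      using less.prems s assms(1) by auto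
    have "card (h j) < card (h (parent j))"
      using h_parent[OF j] parent_index[OF j] finite_h by (intro psubset_card_mono) auto
    moreover have "card (h (parent j)) \<le> card V"
      using parent_index[OF j] h_subset finite_ground by (intro card_mono) auto
    ultimately have "(parent j, a) \<in> R\<^sup>*"
      using s by (intro less.hyps) auto
    then show ?thesis
      using s by (auto intro: converse_rtrancl_into_rtrancl)
  qed simp
qed

text \<open>Components of the tree after a deletion are recognised uniformly: a set of nodes from which one can
  climb to a common node \<open>a\<close> without leaving the set, and which no remaining edge leaves.\<close>

lemma component_eq_of_climb:
  assumes "verts H \<subseteq> I" "edges H \<subseteq> I - {root}" "ends H = (\<lambda>i. {i, parent i})"
    and "S \<subseteq> verts H" "v \<in> S"
    and climb: "\<And>j. j \<in> S \<Longrightarrow> j \<noteq> a \<Longrightarrow> j \<in> edges H \<and> parent j \<in> S"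
    and closed: "\<And>j. j \<in> edges H \<Longrightarrow> j \<in> S \<longleftrightarrow> parent j \<in> S"
  shows "component H v = S"
proof (rule component_eqI)
  show "b \<in> S" if "e \<in> edges H" "ends H e = {c, b}" "c \<in> S" for e c b
    using that closed[of e] assms(3) by (auto simp: doubleton_eq_iff)
  show "(w, a) \<in> (adj H)\<^sup>*" if "w \<in> S" for w
  proof (rule climb_to[OF _ _ that])
    show "S \<subseteq> I"
      using assms by blast
    fix j assume j: "j \<in> S" "j \<noteq> a"
    then have "(j, parent j) \<in> adj H"
      using climb[OF j] assms(3,4) by (auto simp: adj_def)
    then show "j \<noteq> root \<and> parent j \<in> S \<and> (j, parent j) \<in> adj H"
      using climb[OF j] assms(2) by auto
  qed
qed (use assms in auto)

lemma tree_graph_is_tree: "tree tree_graph"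
  unfolding tree_def
proof (intro conjI)
  have "parent i \<noteq> i" if "i \<in> I" "i \<noteq> root" for i
    using h_parent[OF that] by auto
  then show "multigraph tree_graph"
    using finite_index parent_index by (auto simp: multigraph_def tree_graph_def card_2_iff)
  have "component tree_graph v = I" if "v \<in> I" for v
    by (rule component_eq_of_climb[where a = root])
      (use that parent_index in \<open>auto simp: tree_graph_def\<close>)
  then show "connected tree_graph"
    using root_index by (auto simp: connected_def tree_graph_def)
  show "\<nexists>vs es. cycle tree_graph vs es"
  proof (intro notI, elim exE)
    fix vs es assume c: "cycle tree_graph vs es"
    then obtain f where f: "f \<in> set es"
      by (metis cycle_def list.set_sel(1))
    then have fI: "f \<in> I" "f \<noteq> root"
      using c by (auto simp: cycle_def walk_def tree_graph_def)
    show False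
    proof (rule no_cycle_through_bridge[OF c f])
      show "ends tree_graph f = {f, parent f}"
        by (simp add: tree_graph_def)
      show "f \<in> down f" "parent f \<notin> down f"
        using fI by (auto simp: self_in_down parent_notin_down)
      fix e x y assume "e \<in> edges tree_graph" "e \<noteq> f" "ends tree_graph e = {x, y}"
      then show "x \<in> down f \<longleftrightarrow> y \<in> down f"
        using parent_in_down_iff[of f e] fI by (auto simp: tree_graph_def doubleton_eq_iff)
    qed
  qed
qed

lemma component_delete_edge:
  assumes i: "i \<in> I" "i \<noteq> root"
  shows "component (delete_edge tree_graph i) i = down i"
    and "component (delete_edge tree_graph i) (parent i) = I - down i"
proof -
  show "component (delete_edge tree_graph i) i = down i"
    by (rule component_eq_of_climb[where a = i])
      (use i parent_in_down_iff[OF i(1)] root_notin_down[OF i] self_in_down down_subset parent_index in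
        \<open>auto simp: tree_graph_def delete_edge_def\<close>)
  show "component (delete_edge tree_graph i) (parent i) = I - down i"
    by (rule component_eq_of_climb[where a = root])
      (use i parent_in_down_iff[OF i(1)] parent_notin_down self_in_down parent_index in
        \<open>auto simp: tree_graph_def delete_edge_def\<close>)
qed

text \<open>Each component of the tree without \<open>s\<close> is one side of a tree edge: either the subtree below a
  child of \<open>s\<close>, or everything outside the subtree below \<open>s\<close>. Its union of bags therefore has a cut
  from the laminar family.\<close>

lemma components_delete_vertex:
  assumes s: "s \<in> I" and C: "C \<in> components (delete_vertex tree_graph s)"
  shows "\<exists>i\<in>I - {root}. C = down i \<or> C = I - down i"
proof -
  let ?H = "delete_vertex tree_graph s"
  have H: "verts ?H = I - {s}" "edges ?H = {j \<in> I - {root}. s \<noteq> j \<and> s \<noteq> parent j}"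
    "ends ?H = (\<lambda>i. {i, parent i})"
    by (auto simp: delete_vertex_def tree_graph_def)
  obtain w where w: "w \<in> I" "w \<noteq> s" and Cw: "C = component ?H w"
    using C by (auto simp: components_def H)
  show ?thesis
  proof (cases "w \<in> down s")
    case True
    \<comment> \<open>The child of \<open>s\<close> above \<open>w\<close> is the node with the largest set between those of \<open>w\<close> and \<open>s\<close>.\<close>
    define U where "U = {c \<in> I. h w \<subseteq> h c \<and> h c \<subset> h s}"
    have "w \<in> U"
      using True w s inj_h by (auto simp: U_def down_def dest: inj_onD)
    moreover have "card (h c) \<le> card V" if "c \<in> U" for c
      using that h_subset finite_ground by (intro card_mono) (auto simp: U_def)
    ultimately obtain c where c: "c \<in> U" and max: "\<And>d. d \<in> U \<Longrightarrow> card (h d) \<le> card (h c)"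
      using ex_has_greatest_nat[of "\<lambda>c. c \<in> U" w "\<lambda>c. card (h c)" "Suc (card V)"]
      by (auto simp: less_Suc_eq_le)
    have cI: "c \<in> I" "c \<noteq> root"
      using c h_root h_subset[OF s] by (auto simp: U_def)
    have "h (parent c) \<subseteq> h s"
      using c s by (intro parent_least[OF cI]) (auto simp: U_def)
    moreover have "\<not> h (parent c) \<subset> h s"
    proof
      assume "h (parent c) \<subset> h s"
      then have "parent c \<in> U"
        using c parent_index[OF cI] h_parent[OF cI] by (auto simp: U_def)
      then show False
        using max[of "parent c"] psubset_card_mono[OF finite_h[OF parent_index[OF cI]] h_parent[OF cI]]
        by simp
    qed
    ultimately have pc: "parent c = s"
      using inj_h parent_index[OF cI] s by (auto dest: inj_onD)
    have down_c: "s \<notin> down c" "w \<in> down c"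
      using c w by (auto simp: U_def down_def)
    have "j \<in> I \<and> j \<noteq> root \<and> parent j \<in> down c" if "j \<in> down c" "j \<noteq> c" for j
      using that parent_in_down_iff[OF cI(1)] root_notin_down[OF cI] down_subset[of c] by blast
    then have "component ?H w = down c"
      using down_c pc cI parent_in_down_iff[OF cI(1)] down_subset[of c]
      by (intro component_eq_of_climb[where a = c]) (auto simp: H)
    then show ?thesis
      using Cw cI by blast
  next
    case False
    then have "s \<noteq> root"
      using w h_root h_subset by (auto simp: down_def)
    have "parent j \<in> I \<and> parent j \<notin> down s \<and> parent j \<noteq> s"
      if "j \<in> I" "j \<notin> down s" "j \<noteq> root" for j
      using that parent_in_down_iff[OF s, of j] self_in_down[OF s] parent_index[of j] by metis
    then have "component ?H w = I - down s"
      using False w s \<open>s \<noteq> root\<close> parent_in_down_iff[OF s] self_in_down[OF s]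
      by (intro component_eq_of_climb[where a = root]) (auto simp: H)
    then show ?thesis
      using Cw s \<open>s \<noteq> root\<close> by blast
  qed
qed

lemma disjoint_bags: "disjoint_family_on bag I"
  unfolding disjoint_family_on_def
proof (intro ballI impI)
  fix i j assume ij: "i \<in> I" "j \<in> I" "i \<noteq> j"
  then have "h i \<noteq> h j"
    using inj_h by (auto dest: inj_onD)
  then show "bag i \<inter> bag j = {}"
    using nested_if_common[OF ij(1,2)] ij unfolding bag_def by blast
qed

lemma Union_bag_down:
  assumes i: "i \<in> I"
  shows "(\<Union>j\<in>down i. bag j) = h i"
proof (intro equalityI subsetI)
  fix x assume x: "x \<in> h i"
  define U where "U = {j \<in> I. x \<in> h j \<and> h j \<subseteq> h i}"
  have "i \<in> U"
    using i x by (simp add: U_def)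
  then obtain j where j: "j \<in> U" and least: "\<And>k. k \<in> U \<Longrightarrow> card (h j) \<le> card (h k)"
    using ex_has_least_nat[of "\<lambda>c. c \<in> U" i "\<lambda>c. card (h c)"] by blast
  have "x \<notin> h k" if "k \<in> I" "h k \<subset> h j" for k
    using least[of k] psubset_card_mono[OF finite_h that(2)] that j by (auto simp: U_def)
  then show "x \<in> (\<Union>j\<in>down i. bag j)"
    using j by (auto simp: U_def down_def bag_def)
qed (auto simp: bag_def down_def)

lemma Union_bag: "(\<Union>j\<in>I. bag j) = V"
proof -
  have "down root = I"
    using h_root h_subset by (auto simp: down_def)
  then show ?thesis
    using Union_bag_down[OF root_index] h_root by simp
qed

lemma Union_bag_diff_down:
  assumes "i \<in> I"
  shows "(\<Union>j\<in>I - down i. bag j) = V - h i"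
proof -
  have "(\<Union>j\<in>I - down i. bag j) \<inter> (\<Union>j\<in>down i. bag j) = {}"
    using disjoint_bags down_subset[of i] by (fastforce simp: disjoint_family_on_def)
  moreover have "(\<Union>j\<in>I - down i. bag j) \<union> (\<Union>j\<in>down i. bag j) = V"
    unfolding Union_bag[symmetric] by (auto simp: down_def)
  ultimately show ?thesis
    using Union_bag_down[OF assms] by auto
qed

lemma bag_not_separated:
  assumes "i \<in> I" "j \<in> I" "u \<in> bag i" "v \<in> bag i"
  shows "\<not> separates (h j) u v"
  using nested_if_common[OF assms(1,2)] assms unfolding separates_def bag_def by blast

lemma tree_cut_decomposition_tree_graph:
  "verts G = V \<Longrightarrow> tree_cut_decomposition G tree_graph bag"
  using tree_graph_is_tree disjoint_bags Union_bag
  by (simp add: tree_cut_decomposition_def tree_graph_def)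

text \<open>The two sides of the tree edge named \<open>i\<close> have the unions of bags \<open>h i\<close> and \<open>V - h i\<close>, which
  have the same cut.\<close>

lemma adhesion_less:
  assumes G: "multigraph G" "verts G = V" and "k > 0"
    and small: "\<And>i. i \<in> I \<Longrightarrow> i \<noteq> root \<Longrightarrow> card (cut G (h i)) < k"
  shows "adhesion G tree_graph bag < k"
proof (cases "edges tree_graph = {}")
  case True
  then show ?thesis
    using \<open>k > 0\<close> by (simp add: adhesion_def)
next
  case False
  let ?M = "{card (cut G (\<Union>s\<in>component (delete_edge tree_graph f) v. bag s)) | f v.
    f \<in> edges tree_graph \<and> v \<in> ends tree_graph f}"
  have sub: "?M \<subseteq> {..<k}"
  proof
    fix m assume "m \<in> ?M"
    then obtain i v where i: "i \<in> I" "i \<noteq> root" and v: "v = i \<or> v = parent i"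
      and m: "m = card (cut G (\<Union>s\<in>component (delete_edge tree_graph i) v. bag s))"
      by (auto simp: tree_graph_def)
    have "m = card (cut G (h i))"
      using v m component_delete_edge[OF i] Union_bag_down[OF i(1)] Union_bag_diff_down[OF i(1)]
        cut_complement[OF G(1), of "h i"] G(2) by auto
    then show "m \<in> {..<k}"
      using small[OF i] by simp
  qed
  moreover have "finite ?M"
    using finite_subset[OF sub] by simp
  moreover have "?M \<noteq> {}"
    using False by (auto simp: tree_graph_def)
  ultimately have "Max ?M < k"
    using Max_in[of ?M] by blast
  then show ?thesis
    using False by (simp add: adhesion_def)
qed

text \<open>An edge at a consolidated vertex of the torso has one end inside and one end outside the
  consolidated set, so the degree of that vertex is at most the size of a cut from the laminar family.
  All other vertices of the torso come from the bag.\<close>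

lemma torso_bounded_degree:
  assumes G: "multigraph G" "verts G = V"
    and small: "\<And>i. i \<in> I \<Longrightarrow> i \<noteq> root \<Longrightarrow> card (cut G (h i)) < k"
    and s: "s \<in> I" "card (bag s) \<le> t"
  shows "bounded_degree t k (torso G tree_graph bag s)"
proof -
  let ?comps = "components (delete_vertex tree_graph s)"
  let ?Z = "\<lambda>C. \<Union>x\<in>C. bag x"
  let ?H = "torso G tree_graph bag s"
  have finB: "finite (bag s)"
    using finite_h[OF s(1)] by (simp add: bag_def)
  have finE: "finite (edges G)"
    using G by (simp add: multigraph_def)
  have "x \<in> bag s" if x: "x \<in> V" "x \<notin> (\<Union>C\<in>?comps. ?Z C)" for x
  proof -
    obtain j where j: "j \<in> I" "x \<in> bag j"
      using x(1) Union_bag by auto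
    have "j = s"
    proof (rule ccontr)
      assume "j \<noteq> s"
      then have "j \<in> verts (delete_vertex tree_graph s)"
        using j by (simp add: delete_vertex_def tree_graph_def)
      then have "j \<in> component (delete_vertex tree_graph s) j"
        "component (delete_vertex tree_graph s) j \<in> ?comps"
        by (auto simp: component_eq_reachable components_def)
      then show False
        using x(2) j by blast
    qed
    then show ?thesis
      using j by simp
  qed
  moreover have "degree ?H (Inr C) < k" if C: "C \<in> ?comps" for C
  proof -
    obtain i where i: "i \<in> I" "i \<noteq> root" and Ci: "C = down i \<or> C = I - down i"
      using components_delete_vertex[OF s(1) C] by auto
    have cutC: "cut G (?Z C) = cut G (h i)"
      using Ci Union_bag_down[OF i(1)] Union_bag_diff_down[OF i(1)]
        cut_complement[OF G(1), of "h i"] G(2) by auto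
    have "{e \<in> edges ?H. Inr C \<in> ends ?H e} \<subseteq> cut G (?Z C)"
    proof
      fix e assume "e \<in> {e \<in> edges ?H. Inr C \<in> ends ?H e}"
      then have e: "e \<in> edges G" "\<not> ends G e \<subseteq> ?Z C" "ends G e \<inter> ?Z C \<noteq> {}"
        using C by (auto simp: torso_def consolidate_def)
      obtain a b where ab: "ends G e = {a, b}" "a \<noteq> b"
        using multigraph_edgeE[OF G(1) e(1)] by metis
      then have "(a \<in> ?Z C) \<noteq> (b \<in> ?Z C)"
        using e by auto
      then show "e \<in> cut G (?Z C)"
        using e(1) ab(1) card_ends_Int_eq_1[OF ab(2)] by (simp add: cut_def)
    qed
    moreover have "finite (cut G (?Z C))"
      using finE by (simp add: cut_def)
    ultimately have "degree ?H (Inr C) \<le> card (cut G (?Z C))"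
      unfolding degree_def by (rule card_mono[rotated])
    then show ?thesis
      using cutC small[OF i] by simp
  qed
  ultimately have "{v \<in> verts ?H. degree ?H v \<ge> k} \<subseteq> Inl ` bag s"
    using G(2) by (fastforce simp: torso_def consolidate_def)
  then have "card {v \<in> verts ?H. degree ?H v \<ge> k} \<le> card (Inl ` bag s :: ('v + 's set) set)"
    using finB by (intro card_mono) auto
  also have "\<dots> = card (bag s)"
    by (simp add: card_image)
  finally show ?thesis
    using s(2) by (simp add: bounded_degree_def)
qed

end

section \<open>The decomposition\<close>

theorem theorem6:
  fixes G :: "('v, 'e) graph" and t :: nat
  assumes "multigraph G"
    and "t \<ge> 1"
    and "\<not> admits_weak_immersion G (complete_graph t)"
  shows "\<exists>(T :: (nat, nat) graph) (X :: nat \<Rightarrow> 'v set).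
           tree_cut_decomposition G T X \<and> adhesion G T X < t\<^sup>2 \<and>
           (\<forall>s\<in>verts T. bounded_degree t (t\<^sup>2) (torso G T X s))"
proof -
  note G = assms(1)
  have finV: "finite (verts G)"
    using G by (simp add: multigraph_def)
  obtain L where L: "laminar L"
    and L_cut: "\<And>A. A \<in> L \<Longrightarrow> A \<noteq> {} \<and> A \<subset> verts G \<and> card (cut G A) < t\<^sup>2"
    and L_sep: "\<And>u v C. \<lbrakk>u \<in> verts G; v \<in> verts G; C \<subseteq> verts G; separates C u v;
      card (cut G C) < t\<^sup>2\<rbrakk> \<Longrightarrow> \<exists>A\<in>L. separates A u v"
    using exists_laminar_separating_family[OF G, of "t\<^sup>2"] by metis
  have "finite L"
    using L_cut finV by (intro finite_subset[of L "Pow (verts G)"]) auto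
  then obtain h where h: "bij_betw h {0..<card (insert (verts G) L)} (insert (verts G) L)"
    using ex_bij_betw_nat_finite[of "insert (verts G) L"] by auto
  define I where "I = {0..<card (insert (verts G) L)}"
  have hI: "h ` I = insert (verts G) L" and inj: "inj_on h I"
    using h by (auto simp: bij_betw_def I_def)
  then obtain root where root: "root \<in> I" "h root = verts G"
    by (metis imageE insertI1)
  have h_L: "h i \<in> L" if "i \<in> I" "i \<noteq> root" for i
  proof -
    have "h i \<noteq> verts G"
      using that inj root by (metis inj_onD)
    then show ?thesis
      using that(1) hI by blast
  qed
  interpret laminar_index "verts G" I h root
  proof
    show "laminar (h ` I)"
      using L L_cut unfolding hI laminar_def by blast
    show "h i \<subseteq> verts G" if "i \<in> I" for i
      using that hI L_cut by blast
    show "h i \<noteq> {}" if "i \<in> I" "i \<noteq> root" for i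
      using h_L[OF that] L_cut by blast
  qed (use finV inj root in \<open>auto simp: I_def\<close>)
  have small: "card (cut G (h i)) < t\<^sup>2" if "i \<in> I" "i \<noteq> root" for i
    using L_cut[OF h_L[OF that]] by simp
  have "card (bag s) < t" if s: "s \<in> I" for s
  proof (rule ccontr)
    obtain n where n: "t = Suc n"
      using assms(2) by (cases t) auto
    assume "\<not> card (bag s) < t"
    then obtain S where S: "S \<subseteq> bag s" "card S = Suc n"
      using obtain_subset_with_card_n[of "Suc n" "bag s"] n by auto
    have SV: "S \<subseteq> verts G"
      using S(1) h_subset[OF s] by (auto simp: bag_def)
    have "admits_weak_immersion G (complete_graph (Suc n))"
    proof (rule clique_immersion_of_highly_connected_set[OF G SV S(2)])
      fix A u v assume A: "A \<subseteq> verts G" and uv: "u \<in> S" "v \<in> S" "u \<in> A" "v \<notin> A"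
      show "n * n \<le> card (cut G A)"
      proof (rule ccontr)
        assume "\<not> ?thesis"
        then have "card (cut G A) < t\<^sup>2"
          by (simp add: n power2_eq_square)
        then obtain B where B: "B \<in> L" "separates B u v"
          using L_sep[of u v A] A uv SV by (auto simp: separates_def)
        then obtain j where "j \<in> I" "B = h j"
          using hI by blast
        then show False
          using bag_not_separated[OF s, of j u v] B uv S(1) by auto
      qed
    qed
    then show False
      using assms(3) n by simp
  qed
  then have "\<forall>s\<in>verts tree_graph. bounded_degree t (t\<^sup>2) (torso G tree_graph bag s)"
    using torso_bounded_degree[OF G refl small] by (simp add: tree_graph_def less_imp_le)
  moreover have "adhesion G tree_graph bag < t\<^sup>2"
    using assms(2) by (intro adhesion_less[OF G refl _ small]) auto
  ultimately show ?thesis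
    using tree_cut_decomposition_tree_graph[of G] by blast
qed

end
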